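(* Let $\mathcal{X}$ be a set, $n\ge 1$, $f:\mathcal{X}^n\to\mathbb{R}$, and let $s,t,\sigma>0$, with $S_f^t(x)<\infty$ for all $x\in\mathcal{X}^n$. Let $Z$ be distributed as $\mathsf{LLN}(\sigma)$. Then the randomized algorithm $M:\mathcal{X}^n\to\mathbb{R}$ given by $$M(x)=f(x)+\frac1s\cdot S_f^t(x)\cdot Z$$ is $\frac12\varepsilon^2$-CDP for $\varepsilon=\frac{t}{\sigma}+e^{3\sigma^2/2}\,s$.
   Context: $\mathsf{LLN}(\sigma)$ (Laplace log-normal), $\sigma>0$, is the distribution of $X e^{\sigma Y}$ where $X$ is standard Laplace (density $e^{-|x|}/2$), $Y$ is standard Gaussian, and $X,Y$ are independent. For $x,y\in\mathcal{X}^n$, $d(x,y)$ is the number of entries in which they differ; $x,y$ are neighboring if $d(x,y)\le1$. The local sensitivity is $\mathsf{LS}_f(x)=\sup_{y:d(x,y)\le1}|f(y)-f(x)|$, and the $t$-smoothed sensitivity is $S_f^t(x)=\sup_{y\in\mathcal{X}^n}e^{-t\,d(x,y)}\,\mathsf{LS}_f(y)$. For $\alpha\in(1,\infty)$ the Rényi divergence is $D_\alpha(P\|Q)=\frac{1}{\alpha-1}\log\mathbb{E}_{X\leftarrow P}\left[(P(X)/Q(X))^{\alpha-1}\right]$ (ratio of densities, $+\infty$ if $P$ is not absolutely continuous with respect to $Q$); $D_\alpha$ of random variables means $D_\alpha$ of their distributions. A randomized algorithm $M$ on $\mathcal{X}^n$ is $\frac12\varepsilon^2$-CDP if $D_\alpha(M(x)\|M(y))\le\frac12\varepsilon^2\alpha$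 for all neighboring $x,y\in\mathcal{X}^n$ and all $\alpha\in(1,\infty)$. *)

theory Defs
  imports "HOL-Probability.Probability" "HOL-Library.NList"
begin

text \<open>Datasets are the lists in \<^term>\<open>nlists n X\<close>, i.e. the lists of length \<^term>\<open>n\<close>
  over the set \<^term>\<open>X\<close>.\<close>

definition hamming_dist :: "'a list \<Rightarrow> 'a list \<Rightarrow> nat" where
  "hamming_dist x y = card {i. i < length x \<and> x ! i \<noteq> y ! i}"

definition local_sensitivity ::
    "'a set \<Rightarrow> nat \<Rightarrow> ('a list \<Rightarrow> real) \<Rightarrow> 'a list \<Rightarrow> ennreal" where
  "local_sensitivity X n f x =
     (SUP y\<in>{y \<in> nlists n X. hamming_dist x y \<le> 1}. ennreal \<bar>f y - f x\<bar>)"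

definition smooth_sensitivity ::
    "'a set \<Rightarrow> nat \<Rightarrow> ('a list \<Rightarrow> real) \<Rightarrow> real \<Rightarrow> 'a list \<Rightarrow> ennreal" where
  "smooth_sensitivity X n f t x =
     (SUP y\<in>nlists n X.
        ennreal (exp (- t * real (hamming_dist x y))) * local_sensitivity X n f y)"

definition LLN :: "real \<Rightarrow> real measure" where
  "LLN \<sigma> =
     distr (density lborel (\<lambda>x. ennreal (exp (- \<bar>x\<bar>) / 2))
              \<Otimes>\<^sub>M density lborel (\<lambda>y. ennreal (std_normal_density y)))
       borel (\<lambda>(x, y). x * exp (\<sigma> * y))"

text \<open>The density ratio $P/Q$ is the Radon--Nikodym derivative \<^term>\<open>RN_deriv Q P\<close>, so that
  distributions without a Lebesgue density, such as point masses, are covered. For probability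
  measures with \<^term>\<open>P\<close> absolutely continuous with respect to \<^term>\<open>Q\<close> it is finite
  almost everywhere, hence \<^const>\<open>enn2real\<close> below loses nothing, and the moment
  is at least 1, so that \<^const>\<open>ln\<close> is applied to a positive number.\<close>

definition renyi_moment :: "real \<Rightarrow> 'a measure \<Rightarrow> 'a measure \<Rightarrow> ennreal" where
  "renyi_moment \<alpha> P Q = (\<integral>\<^sup>+ z. ennreal (enn2real (RN_deriv Q P z) powr (\<alpha> - 1)) \<partial>P)"

definition renyi_divergence :: "real \<Rightarrow> 'a measure \<Rightarrow> 'a measure \<Rightarrow> ereal" where
  "renyi_divergence \<alpha> P Q =
     (if absolutely_continuous Q P \<and> renyi_moment \<alpha> P Q < \<infinity>
      then ereal (1 / (\<alpha> - 1) * ln (enn2real (renyi_moment \<alpha> P Q)))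
      else \<infinity>)"

text \<open>A randomized algorithm is given by the map sending each dataset to its output
  distribution.\<close>

definition CDP ::
    "'a set \<Rightarrow> nat \<Rightarrow> real \<Rightarrow> ('a list \<Rightarrow> 'b measure) \<Rightarrow> bool" where
  "CDP X n \<rho> M \<longleftrightarrow>
     (\<forall>x \<in> nlists n X. \<forall>y \<in> nlists n X. hamming_dist x y \<le> 1 \<longrightarrow>
        (\<forall>\<alpha>>1. renyi_divergence \<alpha> (M x) (M y) \<le> ereal (\<rho> * \<alpha>)))"

end

theory Submission
  imports Defs
begin

text \<open>
  Neighbouring inputs \<open>x\<close> and \<open>y\<close> give two noise distributions that differ in scale and in
  centre. The smoothed sensitivities differ by a factor of at most $e^t$
  (\<open>smooth_sensitivity_le_exp_mult\<close>), and the centres \<open>f x\<close> and \<open>f y\<close> differ by at most the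
  smoothed sensitivity, that is by at most \<open>s\<close> times the scale of the noise at either point.
  The two differences are paid for separately, by passing through the distribution with the
  centre of the first and the scale of the second.

  The log-normal factor handles the scale. Multiplying $e^{\sigma Y}$ by a factor in
  $[e^{-t},e^t]$ shifts the Gaussian $Y$ by at most $t/\sigma$. Two Gaussians of variance 1 at
  distance $m$ have Renyi divergence $\frac12m^2\alpha$ (\<open>renyi_integral_normal_shift\<close>), and
  passing from $Y$ to the observed noise does not increase it (\<open>renyi_integral_jensen\<close>).

  The Laplace factor handles the centre. A mixture of centred Laplace densities is a mixture of
  the exponentials $e^{-rw}$ in $r=|z|$, so the size of its logarithmic derivative is largest at the
  centre, where it is a quotient of two Gaussian exponential moments and equals $e^{3\sigma^2/2}$ at unit
  scale (\<open>lln_density_log_lipschitz\<close>). A translation by at most \<open>s\<close> times the scale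
  therefore changes the density by a factor of at most $e^\eta$ with $\eta=e^{3\sigma^2/2}s$, and
  such a bound on the ratio gives divergence at most $\frac12\eta^2\alpha$
  (\<open>renyi_integral_bounded_ratio\<close>).

  The quadratic bounds for the two steps are combined by an optimized Hoelder inequality, under
  which the parameters $t/\sigma$ and $\eta$ add (\<open>renyi_integral_triangle\<close>). If the smoothed
  sensitivity vanishes at one of the two inputs, it vanishes at the other as well, and both
  outputs are the same point mass.
\<close>

section \<open>Moments of density ratios\<close>

text \<open>For densities \<^term>\<open>p\<close> and \<^term>\<open>q\<close> this is
  $\exp((\alpha-1)D_\alpha(p\|q))$. Divergence bounds are stated throughout in the form
  $\exp(\alpha(\alpha-1)c^2/2)$, that is $D_\alpha(p\|q)\le c^2\alpha/2$, the shape in which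
  the parameter \<^term>\<open>c\<close> turns out to be additive.\<close>
definition renyi_integral :: "real \<Rightarrow> 'a measure \<Rightarrow> ('a \<Rightarrow> real) \<Rightarrow> ('a \<Rightarrow> real) \<Rightarrow> ennreal" where
  "renyi_integral \<alpha> M p q = (\<integral>\<^sup>+ z. ennreal (p z powr \<alpha> * q z powr (1 - \<alpha>)) \<partial>M)"

text \<open>This is Hoelder's inequality with exponents $1/l$ and $1/(1-l)$, for upper bounds
  \<^term>\<open>I\<close> and \<^term>\<open>J\<close> in place of the integrals themselves: after normalizing by
  them, it is the integrated form of Young's inequality.\<close>
lemma nn_integral_geometric_mean_le:
  fixes A B :: "'a \<Rightarrow> real"
  assumes [measurable]: "A \<in> borel_measurable M" "B \<in> borel_measurable M"
    and pos: "\<And>z. A z > 0" "\<And>z. B z > 0"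
    and I: "(\<integral>\<^sup>+ z. ennreal (A z) \<partial>M) \<le> ennreal I" "I > 0"
    and J: "(\<integral>\<^sup>+ z. ennreal (B z) \<partial>M) \<le> ennreal J" "J > 0"
    and l: "0 \<le> l" "l \<le> 1"
  shows "(\<integral>\<^sup>+ z. ennreal (A z powr l * B z powr (1 - l)) \<partial>M) \<le> ennreal (I powr l * J powr (1 - l))"
proof -
  define C where "C = I powr l * J powr (1 - l)"
  have C: "C > 0" using I J by (simp add: C_def)
  have ptw: "A z powr l * B z powr (1 - l) \<le> C * l / I * A z + C * (1 - l) / J * B z" for z
  proof -
    have "(A z / I) powr l * (B z / J) powr (1 - l) \<le> l * (A z / I) + (1 - l) * (B z / J)"
      using l pos I J by (intro Youngs_inequality_0) auto
    then have "C * ((A z / I) powr l * (B z / J) powr (1 - l)) \<le> C * (l * (A z / I) + (1 - l) * (B z / J))"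
      using C by (intro mult_left_mono) auto
    moreover have "C * ((A z / I) powr l * (B z / J) powr (1 - l)) = A z powr l * B z powr (1 - l)"
      using pos[of z] I J by (simp add: C_def powr_divide)
    ultimately show ?thesis by (simp add: algebra_simps)
  qed
  have "(\<integral>\<^sup>+ z. ennreal (A z powr l * B z powr (1 - l)) \<partial>M)
      \<le> (\<integral>\<^sup>+ z. ennreal (C * l / I) * ennreal (A z) + ennreal (C * (1 - l) / J) * ennreal (B z) \<partial>M)"
    using pos I J l C ptw
    by (intro nn_integral_mono) (simp add: ennreal_mult' [symmetric] ennreal_plus [symmetric] less_imp_le del: ennreal_plus)
  also have "\<dots> = ennreal (C * l / I) * (\<integral>\<^sup>+ z. ennreal (A z) \<partial>M) + ennreal (C * (1 - l) / J) * (\<integral>\<^sup>+ z. ennreal (B z) \<partial>M)"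
    by (subst nn_integral_add) (auto simp: nn_integral_cmult)
  also have "\<dots> \<le> ennreal (C * l / I) * ennreal I + ennreal (C * (1 - l) / J) * ennreal J"
    using I J by (intro add_mono mult_left_mono) auto
  also have "\<dots> = ennreal (C * l / I * I + C * (1 - l) / J * J)"
    using I J C l by (simp add: ennreal_mult' [symmetric] ennreal_plus [symmetric] del: ennreal_plus)
  also have "C * l / I * I + C * (1 - l) / J * J = C"
    using I(2) J(2) by (simp add: distrib_left [symmetric])
  finally show ?thesis by (simp add: C_def)
qed

text \<open>The divergence $D_\alpha$ obeys no triangle inequality at a fixed order. Hoelder's
  inequality does bound the moment of order $\alpha$ between \<^term>\<open>p\<close> and \<^term>\<open>q\<close> by
  moments through \<^term>\<open>r\<close>, but of larger orders $\beta$ and $\gamma$, which depend on the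
  exponents. When all orders are controlled by quadratic bounds, the exponents can be chosen
  to minimize the result, and then \<^term>\<open>c\<close> and \<^term>\<open>d\<close> simply add up.\<close>
lemma renyi_integral_triangle:
  fixes p q r :: "'a \<Rightarrow> real"
  assumes [measurable]: "p \<in> borel_measurable M" "q \<in> borel_measurable M" "r \<in> borel_measurable M"
    and pos: "\<And>z. p z > 0" "\<And>z. q z > 0" "\<And>z. r z > 0"
    and c: "c > 0" "d > 0"
    and pr: "\<And>\<beta>. \<beta> > 1 \<Longrightarrow> renyi_integral \<beta> M p r \<le> ennreal (exp (\<beta> * (\<beta> - 1) * c\<^sup>2 / 2))"
    and rq: "\<And>\<beta>. \<beta> > 1 \<Longrightarrow> renyi_integral \<beta> M r q \<le> ennreal (exp (\<beta> * (\<beta> - 1) * d\<^sup>2 / 2))"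
    and \<alpha>: "\<alpha> > 1"
  shows "renyi_integral \<alpha> M p q \<le> ennreal (exp (\<alpha> * (\<alpha> - 1) * (c + d)\<^sup>2 / 2))"
proof -
  \<comment> \<open>With Hoelder exponents $1+w$ and $(1+w)/w$, the resulting bound contains the terms
    $\alpha^2wc^2+(\alpha-1)^2d^2/w$; this $w$ makes them equal, which minimizes their sum.\<close>
  define w where "w = (\<alpha> - 1) * d / (\<alpha> * c)"
  have w: "w > 0" using \<alpha> c by (simp add: w_def)
  define l where "l = 1 / (1 + w)"
  have l: "0 < l" "l < 1" using w by (auto simp: l_def)
  have l1: "1 - l = w / (1 + w)" using w by (simp add: l_def field_simps)
  define \<beta> where "\<beta> = \<alpha> * (1 + w)"
  define \<gamma> where "\<gamma> = 1 + (\<alpha> - 1) * (1 + w) / w"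
  have \<beta>: "\<beta> > 1" unfolding \<beta>_def using \<alpha> w by (smt (verit) mult_le_cancel_left1)
  have \<gamma>: "\<gamma> > 1" using \<alpha> w by (simp add: \<gamma>_def)
  define A where "A z = p z powr \<beta> * r z powr (1 - \<beta>)" for z
  define B where "B z = r z powr \<gamma> * q z powr (1 - \<gamma>)" for z
  have [measurable]: "A \<in> borel_measurable M" "B \<in> borel_measurable M"
    unfolding A_def B_def by measurable
  have AB: "A z > 0" "B z > 0" for z
    using pos(1)[of z] pos(2)[of z] pos(3)[of z] by (simp_all add: A_def B_def)
  have e1: "\<beta> * l = \<alpha>" using w by (simp add: \<beta>_def l_def)
  have e2: "(1 - \<gamma>) * (1 - l) = 1 - \<alpha>"
  proof -
    have "1 - \<gamma> = (1 - \<alpha>) * ((1 + w) / w)" by (simp add: \<gamma>_def algebra_simps diff_divide_distrib)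
    then show ?thesis using w by (simp add: l1)
  qed
  have e3: "(1 - \<beta>) * l + \<gamma> * (1 - l) = 0"
  proof -
    have "(1 - \<beta>) * l + \<gamma> * (1 - l) = l - \<beta> * l + (1 - l) - (1 - \<gamma>) * (1 - l)" by (simp add: algebra_simps)
    then show ?thesis using e1 e2 by simp
  qed
  have split: "p z powr \<alpha> * q z powr (1 - \<alpha>) = A z powr l * B z powr (1 - l)" for z
  proof -
    have "A z powr l * B z powr (1 - l)
      = p z powr (\<beta> * l) * (r z powr ((1 - \<beta>) * l) * r z powr (\<gamma> * (1 - l))) * q z powr ((1 - \<gamma>) * (1 - l))"
      by (simp add: A_def B_def powr_mult powr_powr mult_ac)
    also have "r z powr ((1 - \<beta>) * l) * r z powr (\<gamma> * (1 - l)) = 1"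
      using pos(3)[of z] by (simp add: powr_add [symmetric] e3)
    finally show ?thesis by (simp add: e1 e2)
  qed
  have "renyi_integral \<alpha> M p q
      \<le> ennreal (exp (\<beta> * (\<beta> - 1) * c\<^sup>2 / 2) powr l * exp (\<gamma> * (\<gamma> - 1) * d\<^sup>2 / 2) powr (1 - l))"
    unfolding renyi_integral_def split
    using AB pr[OF \<beta>] rq[OF \<gamma>] l
    by (intro nn_integral_geometric_mean_le) (auto simp: A_def [abs_def] B_def [abs_def] renyi_integral_def)
  also have "exp (\<beta> * (\<beta> - 1) * c\<^sup>2 / 2) powr l * exp (\<gamma> * (\<gamma> - 1) * d\<^sup>2 / 2) powr (1 - l)
      = exp (\<beta> * (\<beta> - 1) * c\<^sup>2 / 2 * l + \<gamma> * (\<gamma> - 1) * d\<^sup>2 / 2 * (1 - l))"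
    by (simp add: powr_def exp_add mult_ac)
  also have "\<beta> * (\<beta> - 1) * c\<^sup>2 / 2 * l + \<gamma> * (\<gamma> - 1) * d\<^sup>2 / 2 * (1 - l) = \<alpha> * (\<alpha> - 1) * (c + d)\<^sup>2 / 2"
  proof -
    have "\<beta> * (\<beta> - 1) * c\<^sup>2 / 2 * l = (\<beta> * l) * (\<beta> - 1) * c\<^sup>2 / 2" by simp
    also have "\<dots> = (\<alpha> * (\<alpha> - 1) * c\<^sup>2 + \<alpha> * c * (\<alpha> * c * w)) / 2"
      unfolding e1 by (simp add: \<beta>_def algebra_simps power2_eq_square)
    also have "\<alpha> * c * w = (\<alpha> - 1) * d" using \<alpha> c by (simp add: w_def)
    finally have 1: "\<beta> * (\<beta> - 1) * c\<^sup>2 / 2 * l = (\<alpha> * (\<alpha> - 1) * c\<^sup>2 + \<alpha> * c * ((\<alpha> - 1) * d)) / 2" .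
    have "\<gamma> * (\<gamma> - 1) * d\<^sup>2 / 2 * (1 - l) = - (\<gamma> * ((1 - \<gamma>) * (1 - l)) * d\<^sup>2) / 2" by (simp add: field_simps)
    also have "\<dots> = \<gamma> * (\<alpha> - 1) * d\<^sup>2 / 2" unfolding e2 by (simp add: algebra_simps)
    also have "\<dots> = (\<alpha> * (\<alpha> - 1) * d\<^sup>2 + (\<alpha> - 1) * d * ((\<alpha> - 1) * d / w)) / 2"
      using w by (simp add: \<gamma>_def field_simps power2_eq_square)
    also have "(\<alpha> - 1) * d / w = \<alpha> * c" using \<alpha> c by (simp add: w_def)
    finally have 2: "\<gamma> * (\<gamma> - 1) * d\<^sup>2 / 2 * (1 - l) = (\<alpha> * (\<alpha> - 1) * d\<^sup>2 + (\<alpha> - 1) * d * (\<alpha> * c)) / 2" .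
    show ?thesis unfolding 1 2 by (simp add: field_simps power2_eq_square)
  qed
  finally show ?thesis .
qed

text \<open>The logarithm has derivative $\tanh x-x$, which is at most 0 for $x\ge0$.\<close>
lemma cosh_exp_minus_half_square_antimono:
  fixes x y :: real
  assumes "0 \<le> x" "x \<le> y"
  shows "cosh y * exp (- y\<^sup>2 / 2) \<le> cosh x * exp (- x\<^sup>2 / 2)"
proof -
  have s: "sinh z \<le> z * cosh z" if "0 \<le> z" for z :: real
  proof -
    have "0 * cosh 0 - sinh 0 \<le> z * cosh z - sinh z"
    proof (rule DERIV_nonneg_imp_nondecreasing [OF that])
      fix u :: real assume "0 \<le> u" "u \<le> z"
      then show "\<exists>y. ((\<lambda>u. u * cosh u - sinh u) has_real_derivative y) (at u) \<and> 0 \<le> y"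
        by (intro exI[of _ "u * sinh u"]) (auto intro!: derivative_eq_intros)
    qed
    then show ?thesis by simp
  qed
  show ?thesis
  proof (rule DERIV_nonpos_imp_nonincreasing [OF assms(2)])
    fix z assume z: "x \<le> z" "z \<le> y"
    have "((\<lambda>z. cosh z * exp (- z\<^sup>2 / 2)) has_real_derivative (sinh z - z * cosh z) * exp (- z\<^sup>2 / 2)) (at z)"
      by (auto intro!: derivative_eq_intros simp: algebra_simps)
    moreover have "(sinh z - z * cosh z) * exp (- z\<^sup>2 / 2) \<le> 0"
      using s[of z] z assms by (intro mult_nonpos_nonneg) auto
    ultimately show "\<exists>y. ((\<lambda>z. cosh z * exp (- z\<^sup>2 / 2)) has_real_derivative y) (at z) \<and> y \<le> 0" by blast
  qed
qed

text \<open>The left-hand side is the moment for randomized response, the extremal pair of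
  distributions with ratio in $[e^{-\eta},e^\eta]$. It equals
  $\cosh((\gamma-\frac12)\eta)/\cosh(\frac12\eta)$, and
  $(\gamma-\frac12)^2-\frac14=\gamma(\gamma-1)$.\<close>
lemma two_point_moment_le:
  fixes \<eta> \<gamma> :: real
  assumes "\<eta> > 0" "\<gamma> > 1"
  shows "exp (\<gamma> * \<eta>) * (1 / (1 + exp \<eta>)) + exp (- \<gamma> * \<eta>) * (exp \<eta> / (1 + exp \<eta>))
    \<le> exp (\<gamma> * (\<gamma> - 1) * \<eta>\<^sup>2 / 2)"
proof -
  define x where "x = \<eta> / 2"
  define y where "y = (\<gamma> - 1 / 2) * \<eta>"
  have xy: "0 \<le> x" "x \<le> y" using assms by (auto simp: x_def y_def mult_le_cancel_right)
  have two_cosh: "exp z + exp (- z) = 2 * cosh z" for z :: real by (simp add: cosh_field_def)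
  have 1: "exp (\<gamma> * \<eta>) = exp x * exp y" "exp (- \<gamma> * \<eta>) * exp \<eta> = exp x * exp (- y)"
    "exp \<eta> = exp x * exp x"
    by (simp_all add: x_def y_def exp_add [symmetric] field_simps)
  have "exp (\<gamma> * \<eta>) * (1 / (1 + exp \<eta>)) + exp (- \<gamma> * \<eta>) * (exp \<eta> / (1 + exp \<eta>))
      = (exp (\<gamma> * \<eta>) + exp (- \<gamma> * \<eta>) * exp \<eta>) / (1 + exp \<eta>)"
    by (simp add: add_divide_distrib)
  also have "\<dots> = (exp x * (exp y + exp (- y))) / (exp x * (exp x + exp (- x)))"
    unfolding 1(1,2) by (simp add: 1(3) algebra_simps exp_minus)
  also have "\<dots> = cosh y / cosh x"
    using two_cosh[of x] two_cosh[of y] by simp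
  also have "\<dots> \<le> exp (y\<^sup>2 / 2 - x\<^sup>2 / 2)"
  proof -
    have "cosh y * exp (- y\<^sup>2 / 2) * exp (y\<^sup>2 / 2) \<le> cosh x * exp (- x\<^sup>2 / 2) * exp (y\<^sup>2 / 2)"
      using cosh_exp_minus_half_square_antimono[OF xy] by (intro mult_right_mono) auto
    also have "cosh y * exp (- y\<^sup>2 / 2) * exp (y\<^sup>2 / 2) = cosh y"
      by (simp add: mult.assoc exp_add [symmetric])
    also have "cosh x * exp (- x\<^sup>2 / 2) * exp (y\<^sup>2 / 2) = exp (y\<^sup>2 / 2 - x\<^sup>2 / 2) * cosh x"
      by (simp add: mult.assoc exp_add [symmetric] mult.commute diff_divide_distrib)
    finally show ?thesis by (simp add: pos_divide_le_eq)
  qed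
  also have "y\<^sup>2 / 2 - x\<^sup>2 / 2 = \<gamma> * (\<gamma> - 1) * \<eta>\<^sup>2 / 2"
    by (simp add: x_def y_def power2_eq_square field_simps)
  finally show ?thesis .
qed

text \<open>On $[e^{-\eta},e^\eta]$ the convex function $x^\gamma$ lies below its chord. The chord
  is affine, so its mean at \<^term>\<open>\<lambda>z. r z / q z\<close> under \<^term>\<open>q\<close> depends
  only on the mean of the ratio, which is 1; this reduces the claim to the two-point case.\<close>
lemma renyi_integral_bounded_ratio:
  fixes r q :: "'a \<Rightarrow> real"
  assumes r: "integrable M r" "(\<integral>z. r z \<partial>M) = 1" "\<And>z. r z > 0"
    and q: "integrable M q" "(\<integral>z. q z \<partial>M) = 1" "\<And>z. q z > 0"
    and ratio: "\<And>z. r z \<le> exp \<eta> * q z" "\<And>z. q z \<le> exp \<eta> * r z"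
    and \<eta>: "\<eta> > 0" and \<gamma>: "\<gamma> > 1"
  shows "renyi_integral \<gamma> M r q \<le> ennreal (exp (\<gamma> * (\<gamma> - 1) * \<eta>\<^sup>2 / 2))"
proof -
  define D where "D = exp \<eta> - exp (- \<eta>)"
  have D: "D > 0" using \<eta> by (simp add: D_def)
  \<comment> \<open>Splitting \<^term>\<open>q\<close> as \<^term>\<open>\<lambda>z. u z + v z\<close>, in proportion to the weights
    that write $r/q$ as a convex combination of $e^\eta$ and $e^{-\eta}$, keeps the chord linear
    in the densities.\<close>
  define u where "u z = (r z - exp (- \<eta>) * q z) / D" for z
  define v where "v z = (exp \<eta> * q z - r z) / D" for z
  have uv: "0 \<le> u z" "0 \<le> v z" "u z + v z = q z" "exp \<eta> * u z + exp (- \<eta>) * v z = r z" for z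
  proof -
    have "exp (- \<eta>) * q z \<le> exp (- \<eta>) * (exp \<eta> * r z)" using ratio by (intro mult_left_mono) auto
    also have "\<dots> = r z" by (simp add: exp_minus)
    finally show "0 \<le> u z" using D by (simp add: u_def)
    show "0 \<le> v z" using D ratio by (simp add: v_def)
    have "u z + v z = D * q z / D" by (simp add: u_def v_def D_def add_divide_distrib [symmetric] algebra_simps)
    then show "u z + v z = q z" using D by simp
    have "exp \<eta> * u z + exp (- \<eta>) * v z = D * r z / D"
      by (simp add: u_def v_def D_def add_divide_distrib [symmetric] exp_minus algebra_simps)
    then show "exp \<eta> * u z + exp (- \<eta>) * v z = r z" using D by simp
  qed
  have ptw: "r z powr \<gamma> * q z powr (1 - \<gamma>) \<le> exp (\<gamma> * \<eta>) * u z + exp (- \<gamma> * \<eta>) * v z" for z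
  proof -
    have cvx: "convex_on {0<..} (\<lambda>x::real. x powr \<gamma>)"
      using \<gamma> by (intro convex_on_subset[OF powr_convex]) auto
    define l where "l = u z / q z"
    have l: "0 \<le> l" "1 - l = v z / q z" "0 \<le> 1 - l"
      using uv[of z] q(3)[of z] by (auto simp: l_def field_simps)
    have "(l * exp \<eta> + (1 - l) * exp (- \<eta>)) powr \<gamma> \<le> l * exp \<eta> powr \<gamma> + (1 - l) * exp (- \<eta>) powr \<gamma>"
      using convex_onD[OF cvx, of "1 - l" "exp \<eta>" "exp (- \<eta>)"] l(1,3) by simp
    moreover have "l * exp \<eta> + (1 - l) * exp (- \<eta>) = r z / q z"
      unfolding l(2) using uv(4)[of z, symmetric] by (simp add: l_def add_divide_distrib mult.commute)
    ultimately have "(r z / q z) powr \<gamma> \<le> l * exp (\<gamma> * \<eta>) + (1 - l) * exp (- \<gamma> * \<eta>)"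
      by (simp add: powr_def)
    then have "q z * (r z / q z) powr \<gamma> \<le> q z * (l * exp (\<gamma> * \<eta>) + (1 - l) * exp (- \<gamma> * \<eta>))"
      using q(3)[of z] by (intro mult_left_mono) auto
    also have "\<dots> = exp (\<gamma> * \<eta>) * u z + exp (- \<gamma> * \<eta>) * v z"
      unfolding l(2) using q(3)[of z] by (simp add: l_def field_simps)
    also have "q z * (r z / q z) powr \<gamma> = r z powr \<gamma> * q z powr (1 - \<gamma>)"
      using q(3)[of z] r(3)[of z] by (simp add: powr_divide powr_diff)
    finally show ?thesis .
  qed
  have iu: "integrable M u" "(\<integral>z. u z \<partial>M) = 1 / (1 + exp \<eta>)"
  proof -
    show "integrable M u" unfolding u_def using r q by auto
    have "(\<integral>z. u z \<partial>M) = (1 - exp (- \<eta>)) / D"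
      unfolding u_def using r q by simp
    also have "\<dots> = (1 - exp (- \<eta>)) / ((1 - exp (- \<eta>)) * (1 + exp \<eta>))"
      by (simp add: D_def algebra_simps exp_add [symmetric])
    finally show "(\<integral>z. u z \<partial>M) = 1 / (1 + exp \<eta>)" using \<eta> by simp
  qed
  have iv: "integrable M v" "(\<integral>z. v z \<partial>M) = exp \<eta> / (1 + exp \<eta>)"
  proof -
    show "integrable M v" unfolding v_def using r q by auto
    have "(\<integral>z. v z \<partial>M) = (\<integral>z. q z - u z \<partial>M)"
      using uv(3) by (intro Bochner_Integration.integral_cong) (auto simp: algebra_simps)
    also have "\<dots> = 1 - 1 / (1 + exp \<eta>)" using q iu by simp
    also have "\<dots> = exp \<eta> / (1 + exp \<eta>)" using add_pos_pos[OF zero_less_one exp_gt_zero[of \<eta>]] by (simp add: field_simps)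
    finally show "(\<integral>z. v z \<partial>M) = exp \<eta> / (1 + exp \<eta>)" .
  qed
  have "renyi_integral \<gamma> M r q \<le> (\<integral>\<^sup>+ z. ennreal (exp (\<gamma> * \<eta>) * u z + exp (- \<gamma> * \<eta>) * v z) \<partial>M)"
    unfolding renyi_integral_def by (intro nn_integral_mono ennreal_leI ptw)
  also have "\<dots> = ennreal (\<integral>z. exp (\<gamma> * \<eta>) * u z + exp (- \<gamma> * \<eta>) * v z \<partial>M)"
    using iu iv uv by (intro nn_integral_eq_integral) auto
  also have "(\<integral>z. exp (\<gamma> * \<eta>) * u z + exp (- \<gamma> * \<eta>) * v z \<partial>M)
      = exp (\<gamma> * \<eta>) * (1 / (1 + exp \<eta>)) + exp (- \<gamma> * \<eta>) * (exp \<eta> / (1 + exp \<eta>))"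
    using iu iv by simp
  also have "\<dots> \<le> exp (\<gamma> * (\<gamma> - 1) * \<eta>\<^sup>2 / 2)"
    by (rule two_point_moment_le[OF \<eta> \<gamma>])
  finally show ?thesis by (simp add: ennreal_leI)
qed

text \<open>The function $(a,b)\mapsto a^\beta b^{1-\beta}$ is convex and positively homogeneous, so
  it lies above its tangent planes, which pass through the origin. Integrating the plane that
  touches at the point of the two integrals gives the claim. This is the data-processing
  inequality: mixing over a hidden variable cannot increase the moment.\<close>
lemma renyi_integral_jensen:
  fixes u v :: "'a \<Rightarrow> real"
  assumes u: "integrable M u" "\<And>y. u y > 0" and v: "integrable M v" "\<And>y. v y > 0"
    and pos: "(\<integral>y. u y \<partial>M) > 0" "(\<integral>y. v y \<partial>M) > 0" and \<beta>: "\<beta> > 1"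
  shows "ennreal ((\<integral>y. u y \<partial>M) powr \<beta> * (\<integral>y. v y \<partial>M) powr (1 - \<beta>)) \<le> renyi_integral \<beta> M u v"
proof (cases "renyi_integral \<beta> M u v < \<infinity>")
  case True
  define U where "U = (\<integral>y. u y \<partial>M)"
  define V where "V = (\<integral>y. v y \<partial>M)"
  define c where "c = U / V"
  have UV: "U > 0" "V > 0" using pos by (auto simp: U_def V_def)
  have c: "c > 0" using UV by (simp add: c_def)
  have [measurable]: "u \<in> borel_measurable M" "v \<in> borel_measurable M" using u v by auto
  let ?F = "\<lambda>y. u y powr \<beta> * v y powr (1 - \<beta>)"
  have tangent: "\<beta> * c powr (\<beta> - 1) * u y - (\<beta> - 1) * c powr \<beta> * v y \<le> ?F y" for y
  proof -
    define x where "x = u y / (v y * c)"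
    have x: "x > 0" using u(2)[of y] v(2)[of y] c by (simp add: x_def)
    have "(x powr \<beta>) powr (1 / \<beta>) * 1 powr (1 - 1 / \<beta>) \<le> 1 / \<beta> * x powr \<beta> + (1 - 1 / \<beta>) * 1"
      using \<beta> x by (intro Youngs_inequality_0) auto
    then have "x \<le> 1 / \<beta> * x powr \<beta> + (1 - 1 / \<beta>)" using \<beta> x by (simp add: powr_powr)
    then have "\<beta> * x \<le> \<beta> * (1 / \<beta> * x powr \<beta> + (1 - 1 / \<beta>))"
      using \<beta> by (intro mult_left_mono) auto
    then have "\<beta> * x - (\<beta> - 1) \<le> x powr \<beta>" using \<beta> by (simp add: algebra_simps)
    then have "v y * c powr \<beta> * (\<beta> * x - (\<beta> - 1)) \<le> v y * c powr \<beta> * x powr \<beta>"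
      using v(2)[of y] by (intro mult_left_mono) auto
    moreover have "v y * c powr \<beta> * x powr \<beta> = ?F y"
      using u(2)[of y] v(2)[of y] c by (simp add: x_def powr_divide powr_mult powr_diff)
    moreover have "v y * c powr \<beta> * (\<beta> * x - (\<beta> - 1)) = \<beta> * c powr (\<beta> - 1) * u y - (\<beta> - 1) * c powr \<beta> * v y"
      using v(2)[of y] c by (simp add: x_def powr_diff field_simps)
    ultimately show ?thesis by simp
  qed
  have int: "integrable M ?F"
    using True unfolding renyi_integral_def by (intro integrableI_bounded) (auto simp: abs_mult)
  have "U powr \<beta> * V powr (1 - \<beta>) = \<beta> * c powr (\<beta> - 1) * U - (\<beta> - 1) * c powr \<beta> * V"
  proof -
    have "c powr \<beta> * V = U powr \<beta> * V powr (1 - \<beta>)"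
      using UV by (simp add: c_def powr_divide powr_diff)
    moreover have "c powr (\<beta> - 1) * U = c powr \<beta> * V"
      using UV c by (simp add: c_def powr_diff)
    ultimately show ?thesis by (simp add: algebra_simps)
  qed
  also have "\<dots> = (\<integral>y. \<beta> * c powr (\<beta> - 1) * u y - (\<beta> - 1) * c powr \<beta> * v y \<partial>M)"
    using u v by (simp add: U_def V_def)
  also have "\<dots> \<le> (\<integral>y. ?F y \<partial>M)"
    using u v int tangent by (intro integral_mono) auto
  finally have "ennreal (U powr \<beta> * V powr (1 - \<beta>)) \<le> ennreal (\<integral>y. ?F y \<partial>M)" by (rule ennreal_leI)
  also have "\<dots> = renyi_integral \<beta> M u v"
    unfolding renyi_integral_def using int by (intro nn_integral_eq_integral [symmetric]) auto
  finally show ?thesis by (simp add: U_def V_def)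
qed (simp add: not_less top_unique)

text \<open>Completing the square turns the integrand into a constant multiple of the normal
  density with mean $\beta\mu+(1-\beta)\nu$.\<close>
lemma renyi_integral_normal_shift:
  "renyi_integral \<beta> lborel (normal_density \<mu> 1) (normal_density \<nu> 1) = ennreal (exp (\<beta> * (\<beta> - 1) * (\<mu> - \<nu>)\<^sup>2 / 2))"
proof -
  have eq: "normal_density \<mu> 1 y powr \<beta> * normal_density \<nu> 1 y powr (1 - \<beta>)
      = exp (\<beta> * (\<beta> - 1) * (\<mu> - \<nu>)\<^sup>2 / 2) * normal_density (\<beta> * \<mu> + (1 - \<beta>) * \<nu>) 1 y" for y
  proof -
    define c where "c = 1 / sqrt (2 * pi)"
    have c: "c > 0" by (simp add: c_def)
    have nd: "normal_density m 1 y = c * exp (- (y - m)\<^sup>2 / 2)" for m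
      by (simp add: normal_density_def c_def)
    have "normal_density \<mu> 1 y powr \<beta> * normal_density \<nu> 1 y powr (1 - \<beta>)
       = (c powr \<beta> * c powr (1 - \<beta>)) * exp (\<beta> * (- (y - \<mu>)\<^sup>2 / 2) + (1 - \<beta>) * (- (y - \<nu>)\<^sup>2 / 2))"
      unfolding nd using c by (simp add: powr_mult exp_powr_real exp_add [symmetric] mult_ac)
    also have "c powr \<beta> * c powr (1 - \<beta>) = c" using c by (simp add: powr_add [symmetric])
    also have "\<beta> * (- (y - \<mu>)\<^sup>2 / 2) + (1 - \<beta>) * (- (y - \<nu>)\<^sup>2 / 2)
       = \<beta> * (\<beta> - 1) * (\<mu> - \<nu>)\<^sup>2 / 2 + - (y - (\<beta> * \<mu> + (1 - \<beta>) * \<nu>))\<^sup>2 / 2"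
      by (simp add: power2_eq_square field_simps)
    finally show ?thesis by (simp only: nd exp_add mult_ac)
  qed
  show ?thesis
    unfolding renyi_integral_def eq
    by (subst nn_integral_eq_integral) auto
qed

lemma has_bochner_integral_normal_exp:
  "has_bochner_integral lborel (\<lambda>y. normal_density \<mu> 1 y * exp (c * y)) (exp (c * \<mu> + c\<^sup>2 / 2))"
proof -
  have eq: "normal_density \<mu> 1 y * exp (c * y) = exp (c * \<mu> + c\<^sup>2 / 2) * normal_density (\<mu> + c) 1 y" for y
    by (simp add: normal_density_def exp_add [symmetric]) (simp add: power2_eq_square field_simps)
  show ?thesis unfolding eq by (simp add: has_bochner_integral_iff)
qed

section \<open>Densities of Laplace log-normal noise\<close>

text \<open>The Laplace density in \<^term>\<open>z\<close> centred at \<^term>\<open>a\<close> with scale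
  $e^{\sigma y}$.\<close>
definition lln_kernel :: "real \<Rightarrow> real \<Rightarrow> real \<Rightarrow> real \<Rightarrow> real" where
  "lln_kernel \<sigma> a z y = exp (- \<sigma> * y) / 2 * exp (- \<bar>z - a\<bar> * exp (- \<sigma> * y))"

text \<open>The density of $a+Xe^{\sigma Y}$ for standard Laplace $X$ and normal $Y$ with mean
  \<^term>\<open>\<mu>\<close> and variance 1. Moving the mean of $Y$ is the same as rescaling the noise by
  $e^{\sigma\mu}$; encoding the scale in \<^term>\<open>\<mu>\<close> makes a change of scale a shift of a
  Gaussian, and leaves the kernel unchanged.\<close>
definition lln_density :: "real \<Rightarrow> real \<Rightarrow> real \<Rightarrow> real \<Rightarrow> real" where
  "lln_density \<sigma> \<mu> a z = (\<integral>y. normal_density \<mu> 1 y * lln_kernel \<sigma> a z y \<partial>lborel)"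

lemma lln_kernel_pos: "lln_kernel \<sigma> a z y > 0"
  by (simp add: lln_kernel_def)

lemma borel_measurable_lln_kernel [measurable]:
  "(\<lambda>(z, y). lln_kernel \<sigma> a z y) \<in> borel_measurable (borel \<Otimes>\<^sub>M borel)"
  unfolding lln_kernel_def by measurable

lemma borel_measurable_lln_kernel' [measurable]: "lln_kernel \<sigma> a z \<in> borel_measurable borel"
  unfolding lln_kernel_def by measurable

lemma borel_measurable_lln_density [measurable]: "lln_density \<sigma> \<mu> a \<in> borel_measurable borel"
  unfolding lln_density_def[abs_def] by measurable

lemma integrable_normal_lln_kernel: "integrable lborel (\<lambda>y. normal_density \<mu> 1 y * lln_kernel \<sigma> a z y)"
proof (rule Bochner_Integration.integrable_bound)
  show "integrable lborel (\<lambda>y. normal_density \<mu> 1 y * exp (- \<sigma> * y))"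
    using has_bochner_integral_normal_exp has_bochner_integral_iff by blast
  show "AE y in lborel. norm (normal_density \<mu> 1 y * lln_kernel \<sigma> a z y) \<le> norm (normal_density \<mu> 1 y * exp (- \<sigma> * y))"
  proof (intro AE_I2)
    fix y
    have "exp (- \<sigma> * y) / 2 * exp (- \<bar>z - a\<bar> * exp (- \<sigma> * y)) \<le> exp (- \<sigma> * y) * 1"
      by (intro mult_mono) auto
    then show "norm (normal_density \<mu> 1 y * lln_kernel \<sigma> a z y) \<le> norm (normal_density \<mu> 1 y * exp (- \<sigma> * y))"
      unfolding lln_kernel_def norm_mult by (intro mult_left_mono) auto
  qed
qed simp

lemma ennreal_lln_density:
  "ennreal (lln_density \<sigma> \<mu> a z) = (\<integral>\<^sup>+ y. ennreal (normal_density \<mu> 1 y * lln_kernel \<sigma> a z y) \<partial>lborel)"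
  unfolding lln_density_def using integrable_normal_lln_kernel
  by (intro nn_integral_eq_integral [symmetric]) (auto simp: less_imp_le[OF lln_kernel_pos])

text \<open>With $w=e^{-\sigma y}$ and $r=|z-a|$ the density is half the mean of $we^{-rw}$. Its
  logarithmic derivative in \<^term>\<open>r\<close> is minus the mean of $w$ under the normal law
  reweighted by $we^{-rw}$. These weights favour small $w$ more the larger $r$ is, so that mean is at most its
  value at $r=0$, which is $K=E[w^2]/E[w]=e^{3\sigma^2/2-\sigma\mu}$. The proof replaces
  derivatives by one pointwise inequality whose error term is a multiple of $w(w-K)$ and
  therefore integrates to zero.\<close>
lemma lln_density_log_lipschitz:
  "exp (- (exp (3 * \<sigma>\<^sup>2 / 2 - \<sigma> * \<mu>) * \<bar>a - a'\<bar>)) * lln_density \<sigma> \<mu> a z \<le> lln_density \<sigma> \<mu> a' z"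
proof -
  define K where "K = exp (3 * \<sigma>\<^sup>2 / 2 - \<sigma> * \<mu>)"
  define d where "d = \<bar>a - a'\<bar>"
  define r where "r = \<bar>z - a\<bar>"
  define w where "w y = exp (- \<sigma> * y)" for y
  define g where "g y = normal_density \<mu> 1 y" for y
  define E where "E = d * exp (- d * K) * exp (- r * K) / 2"
  have K: "K > 0" and d: "d \<ge> 0" and r: "r \<ge> 0" by (auto simp: K_def d_def r_def)
  have w: "w y > 0" for y by (simp add: w_def)
  have g: "g y \<ge> 0" for y by (simp add: g_def)
  have kernel: "exp (- d * K) * lln_kernel \<sigma> a z y - E * (w y * w y - K * w y) \<le> lln_kernel \<sigma> a' z y" for y
  proof -
    have kw: "lln_kernel \<sigma> b z y = w y / 2 * exp (- \<bar>z - b\<bar> * w y)" for b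
      by (simp add: lln_kernel_def w_def)
    \<comment> \<open>The tangent bound for the increment \<^term>\<open>d\<close>, to be multiplied by the factor for
      \<^term>\<open>r\<close>.\<close>
    have "- d * w y + d * K + 1 \<le> exp (- d * w y + d * K)" using exp_ge_add_one_self[of "- d * w y + d * K"] by linarith
    then have "exp (- d * K) * (- d * w y + d * K + 1) \<le> exp (- d * K) * exp (- d * w y + d * K)"
      by (intro mult_left_mono) auto
    then have 1: "exp (- d * K) - d * exp (- d * K) * (w y - K) \<le> exp (- d * w y)"
      by (simp add: exp_add [symmetric] algebra_simps)
    \<comment> \<open>The weight $e^{-rw}$ decreases in $w$; freezing it at $w=K$ only increases the product
      with $w-K$.\<close>
    have 2: "(w y - K) * exp (- r * w y) \<le> (w y - K) * exp (- r * K)"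
    proof (cases "w y \<ge> K")
      case True
      then have "exp (- r * w y) \<le> exp (- r * K)" using r by (simp add: mult_left_mono)
      then show ?thesis using True by (intro mult_left_mono) auto
    next
      case False
      then have "exp (- r * K) \<le> exp (- r * w y)" using r by (simp add: mult_left_mono)
      then show ?thesis using False by (intro mult_left_mono_neg) auto
    qed
    have "exp (- d * K) * exp (- r * w y) - d * exp (- d * K) * ((w y - K) * exp (- r * K))
       \<le> exp (- d * K) * exp (- r * w y) - d * exp (- d * K) * ((w y - K) * exp (- r * w y))"
      using d by (intro diff_left_mono mult_left_mono[OF 2]) auto
    also have "\<dots> = (exp (- d * K) - d * exp (- d * K) * (w y - K)) * exp (- r * w y)"
      by (simp add: algebra_simps)
    also have "\<dots> \<le> exp (- d * w y) * exp (- r * w y)"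
      using 1 by (intro mult_right_mono) auto
    also have "\<dots> = exp (- (r + d) * w y)" by (simp add: exp_add [symmetric] algebra_simps)
    also have "\<dots> \<le> exp (- \<bar>z - a'\<bar> * w y)"
      unfolding exp_le_cancel_iff using w[of y] by (intro mult_right_mono) (auto simp: r_def d_def)
    finally have "w y / 2 * (exp (- d * K) * exp (- r * w y) - d * exp (- d * K) * ((w y - K) * exp (- r * K)))
      \<le> w y / 2 * exp (- \<bar>z - a'\<bar> * w y)"
      using w[of y] by (intro mult_left_mono) auto
    then show ?thesis
      unfolding kw by (simp add: r_def [symmetric] E_def field_simps)
  qed
  have i1: "has_bochner_integral lborel (\<lambda>y. g y * w y) (exp (- \<sigma> * \<mu> + \<sigma>\<^sup>2 / 2))"
    using has_bochner_integral_normal_exp[of \<mu> "- \<sigma>"] by (simp add: g_def w_def)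
  have "has_bochner_integral lborel (\<lambda>y. g y * (w y * w y)) (exp (- (2 * \<sigma>) * \<mu> + (2 * \<sigma>)\<^sup>2 / 2))"
    using has_bochner_integral_normal_exp[of \<mu> "- (2 * \<sigma>)"]
    by (simp add: g_def w_def exp_add [symmetric] algebra_simps)
  also have "exp (- (2 * \<sigma>) * \<mu> + (2 * \<sigma>)\<^sup>2 / 2) = K * exp (- \<sigma> * \<mu> + \<sigma>\<^sup>2 / 2)"
    by (simp add: K_def exp_add [symmetric] power2_eq_square field_simps)
  finally have i2: "has_bochner_integral lborel (\<lambda>y. g y * (w y * w y)) (K * exp (- \<sigma> * \<mu> + \<sigma>\<^sup>2 / 2))" .
  have i0: "has_bochner_integral lborel (\<lambda>y. g y * lln_kernel \<sigma> b z y) (lln_density \<sigma> \<mu> b z)" for b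
    using integrable_normal_lln_kernel by (simp add: g_def lln_density_def has_bochner_integral_iff)
  have i3: "has_bochner_integral lborel
      (\<lambda>y. exp (- d * K) * (g y * lln_kernel \<sigma> a z y) - E * (g y * (w y * w y) - K * (g y * w y)))
      (exp (- d * K) * lln_density \<sigma> \<mu> a z - E * (K * exp (- \<sigma> * \<mu> + \<sigma>\<^sup>2 / 2) - K * exp (- \<sigma> * \<mu> + \<sigma>\<^sup>2 / 2)))"
    by (intro has_bochner_integral_diff has_bochner_integral_mult_right i0 i1 i2)
  have "(\<integral>y. exp (- d * K) * (g y * lln_kernel \<sigma> a z y) - E * (g y * (w y * w y) - K * (g y * w y)) \<partial>lborel)
     \<le> (\<integral>y. g y * lln_kernel \<sigma> a' z y \<partial>lborel)"
  proof (rule integral_mono)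
    fix y
    show "exp (- d * K) * (g y * lln_kernel \<sigma> a z y) - E * (g y * (w y * w y) - K * (g y * w y))
       \<le> g y * lln_kernel \<sigma> a' z y"
      using mult_left_mono[OF kernel[of y] g[of y]] by (simp add: algebra_simps)
  qed (use i3 i0 in \<open>auto simp: has_bochner_integral_iff\<close>)
  then have "exp (- d * K) * lln_density \<sigma> \<mu> a z \<le> lln_density \<sigma> \<mu> a' z"
    unfolding has_bochner_integral_integral_eq[OF i3] has_bochner_integral_integral_eq[OF i0] by simp
  then show ?thesis by (simp add: K_def d_def mult.commute)
qed

text \<open>The value at the centre is explicit and positive, and by the logarithmic Lipschitz bound
  positivity spreads from there to all other points.\<close>
lemma lln_density_pos: "lln_density \<sigma> \<mu> a z > 0"
proof -
  have "lln_density \<sigma> \<mu> z z = exp (- \<sigma> * \<mu> + \<sigma>\<^sup>2 / 2) / 2"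
    using has_bochner_integral_normal_exp[of \<mu> "- \<sigma>"]
    by (simp add: lln_density_def lln_kernel_def has_bochner_integral_iff)
  then have "0 < lln_density \<sigma> \<mu> z z" by (metis exp_gt_zero half_gt_zero)
  then have "0 < exp (- (exp (3 * \<sigma>\<^sup>2 / 2 - \<sigma> * \<mu>) * \<bar>z - a\<bar>)) * lln_density \<sigma> \<mu> z z" by simp
  then show ?thesis using lln_density_log_lipschitz[of \<sigma> \<mu> z a z] by linarith
qed

lemma nn_integral_laplace_scale:
  assumes [measurable]: "G \<in> borel_measurable borel"
  shows "(\<integral>\<^sup>+ x. ennreal (exp (- \<bar>x\<bar>) / 2) * G (a + exp (\<sigma> * y) * x) \<partial>lborel) = (\<integral>\<^sup>+ z. ennreal (lln_kernel \<sigma> a z y) * G z \<partial>lborel)"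
proof -
  define v where "v = exp (\<sigma> * y)"
  have v: "v > 0" by (simp add: v_def)
  have inv: "exp (- (\<sigma> * y)) = 1 / v" by (simp add: v_def exp_minus field_simps)
  have "(\<integral>\<^sup>+ z. ennreal (lln_kernel \<sigma> a z y) * G z \<partial>lborel)
     = ennreal \<bar>v\<bar> * (\<integral>\<^sup>+ x. ennreal (lln_kernel \<sigma> a (a + v * x) y) * G (a + v * x) \<partial>lborel)"
    using v unfolding lln_kernel_def by (intro nn_integral_real_affine) auto
  also have "\<dots> = (\<integral>\<^sup>+ x. ennreal \<bar>v\<bar> * (ennreal (lln_kernel \<sigma> a (a + v * x) y) * G (a + v * x)) \<partial>lborel)"
    unfolding lln_kernel_def by (intro nn_integral_cmult [symmetric]) auto
  also have "\<dots> = (\<integral>\<^sup>+ x. ennreal (exp (- \<bar>x\<bar>) / 2) * G (a + v * x) \<partial>lborel)"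
    using v
    by (intro nn_integral_cong)
       (simp add: lln_kernel_def inv abs_mult mult.assoc [symmetric] ennreal_mult' [symmetric] del: mult_minus_left)
  finally show ?thesis by (simp add: v_def)
qed

lemma nn_integral_lln_kernel: "(\<integral>\<^sup>+ z. ennreal (lln_kernel \<sigma> a z y) \<partial>lborel) = 1"
proof -
  have "has_bochner_integral lborel (\<lambda>x::real. indicator {0..} x *\<^sub>R (exp (- \<bar>x\<bar>) / 2)) (1 / 2)"
  proof -
    interpret E: prob_space "density lborel (exponential_density 1)"
      by (rule prob_space_exponential_density) simp
    have "(\<integral>\<^sup>+ x. ennreal (exponential_density 1 x) \<partial>lborel) = ennreal 1"
      using E.emeasure_space_1 by (simp add: emeasure_density)
    then have "has_bochner_integral lborel (exponential_density 1) 1"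
      by (intro has_bochner_integral_nn_integral) (auto simp: exponential_density_def)
    then have "has_bochner_integral lborel (\<lambda>x. exponential_density 1 x / 2) (1 / 2)"
      by (rule has_bochner_integral_divide_zero)
    also have "(\<lambda>x. exponential_density 1 x / 2) = (\<lambda>x::real. indicator {0..} x *\<^sub>R (exp (- \<bar>x\<bar>) / 2))"
      by (auto simp: exponential_density_def fun_eq_iff)
    finally show ?thesis .
  qed
  from has_bochner_integral_even_function[OF this]
  have L: "has_bochner_integral lborel (\<lambda>x::real. exp (- \<bar>x\<bar>) / 2) 1" by simp
  have "(\<integral>\<^sup>+ z. ennreal (lln_kernel \<sigma> a z y) \<partial>lborel) = (\<integral>\<^sup>+ x. ennreal (exp (- \<bar>x\<bar>) / 2) \<partial>lborel)"
    using nn_integral_laplace_scale[of "\<lambda>_. 1" a \<sigma> y] by simp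
  also have "\<dots> = 1"
    using L by (subst nn_integral_eq_integral) (auto simp: has_bochner_integral_iff)
  finally show ?thesis .
qed

text \<open>Since $b\,e^{\sigma Y}=e^{\sigma(Y+\ln b/\sigma)}$, the scale \<^term>\<open>b\<close> is absorbed
  into the mean of the Gaussian.\<close>
lemma distr_affine_LLN:
  assumes "b > 0" "\<sigma> > 0"
  shows "distr (LLN \<sigma>) borel (\<lambda>z. a + b * z) = density lborel (lln_density \<sigma> (ln b / \<sigma>) a)"
proof (rule measure_eqI)
  fix S assume "S \<in> sets (distr (LLN \<sigma>) borel (\<lambda>z. a + b * z))"
  then have [measurable]: "S \<in> sets borel" by simp
  let ?L = "density lborel (\<lambda>x. ennreal (exp (- \<bar>x\<bar>) / 2))"
  let ?N = "density lborel (\<lambda>y. ennreal (std_normal_density y))"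
  interpret N: prob_space ?N by (rule prob_space_normal_density) simp
  have L: "sigma_finite_measure ?L"
    by (subst sigma_finite_measure.sigma_finite_iff_density_finite) (auto intro: sigma_finite_lborel)
  interpret P: pair_sigma_finite ?L ?N
    using L N.sigma_finite_measure_axioms by (simp add: pair_sigma_finite_def)
  define m where "m = ln b / \<sigma>"
  have bm: "b * exp (\<sigma> * y) = exp (\<sigma> * (m + y))" for y
    using assms by (simp add: m_def distrib_left exp_add)
  have "emeasure (distr (LLN \<sigma>) borel (\<lambda>z. a + b * z)) S
     = (\<integral>\<^sup>+ w. indicator S (a + b * (fst w * exp (\<sigma> * snd w))) \<partial>(?L \<Otimes>\<^sub>M ?N))"
    unfolding LLN_def
    by (simp add: nn_integral_distr case_prod_unfold del: nn_integral_indicator flip: nn_integral_indicator)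
  also have "\<dots> = (\<integral>\<^sup>+ y. \<integral>\<^sup>+ x. indicator S (a + b * (x * exp (\<sigma> * y))) \<partial>?L \<partial>?N)"
    by (subst P.nn_integral_snd [symmetric]) auto
  also have "\<dots> = (\<integral>\<^sup>+ y. ennreal (std_normal_density y) *
      (\<integral>\<^sup>+ x. ennreal (exp (- \<bar>x\<bar>) / 2) * indicator S (a + exp (\<sigma> * (m + y)) * x) \<partial>lborel) \<partial>lborel)"
    by (simp add: nn_integral_density bm [symmetric] mult_ac)
  also have "\<dots> = (\<integral>\<^sup>+ y. ennreal (std_normal_density y) *
      (\<integral>\<^sup>+ z. ennreal (lln_kernel \<sigma> a z (m + y)) * indicator S z \<partial>lborel) \<partial>lborel)"
    by (subst nn_integral_laplace_scale) auto
  also have "\<dots> = (\<integral>\<^sup>+ y. ennreal (normal_density m 1 (m + 1 * y)) *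
      (\<integral>\<^sup>+ z. ennreal (lln_kernel \<sigma> a z (m + 1 * y)) * indicator S z \<partial>lborel) \<partial>lborel)"
    by (simp add: normal_density_def)
  also have "\<dots> = (\<integral>\<^sup>+ y. ennreal (normal_density m 1 y) *
      (\<integral>\<^sup>+ z. ennreal (lln_kernel \<sigma> a z y) * indicator S z \<partial>lborel) \<partial>lborel)"
    by (subst nn_integral_real_affine[where c = 1 and t = m]) auto
  also have "\<dots> = (\<integral>\<^sup>+ y. \<integral>\<^sup>+ z. ennreal (normal_density m 1 y * lln_kernel \<sigma> a z y) * indicator S z \<partial>lborel \<partial>lborel)"
    by (simp add: nn_integral_cmult [symmetric] ennreal_mult' mult.assoc less_imp_le[OF lln_kernel_pos])
  also have "\<dots> = (\<integral>\<^sup>+ z. \<integral>\<^sup>+ y. ennreal (normal_density m 1 y * lln_kernel \<sigma> a z y) * indicator S z \<partial>lborel \<partial>lborel)"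
    by (intro lborel_pair.Fubini') auto
  also have "\<dots> = (\<integral>\<^sup>+ z. ennreal (lln_density \<sigma> m a z) * indicator S z \<partial>lborel)"
    by (simp add: ennreal_lln_density nn_integral_multc)
  also have "\<dots> = emeasure (density lborel (lln_density \<sigma> m a)) S"
    by (simp add: emeasure_density)
  finally show "emeasure (distr (LLN \<sigma>) borel (\<lambda>z. a + b * z)) S
     = emeasure (density lborel (lln_density \<sigma> (ln b / \<sigma>) a)) S"
    by (simp add: m_def)
qed simp

lemma lln_density_integral:
  "integrable lborel (lln_density \<sigma> \<mu> a)" "(\<integral>z. lln_density \<sigma> \<mu> a z \<partial>lborel) = 1"
proof -
  have "(\<integral>\<^sup>+ z. ennreal (lln_density \<sigma> \<mu> a z) \<partial>lborel)
     = (\<integral>\<^sup>+ y. \<integral>\<^sup>+ z. ennreal (normal_density \<mu> 1 y * lln_kernel \<sigma> a z y) \<partial>lborel \<partial>lborel)"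
    unfolding ennreal_lln_density by (intro lborel_pair.Fubini') auto
  also have "\<dots> = (\<integral>\<^sup>+ y. ennreal (normal_density \<mu> 1 y) \<partial>lborel)"
    by (simp add: ennreal_mult' nn_integral_cmult nn_integral_lln_kernel)
  also have "\<dots> = ennreal 1"
    by (subst nn_integral_eq_integral) auto
  finally have n: "(\<integral>\<^sup>+ z. ennreal (lln_density \<sigma> \<mu> a z) \<partial>lborel) = ennreal 1" .
  then show "integrable lborel (lln_density \<sigma> \<mu> a)"
    by (intro integrableI_nn_integral_finite[where x = 1]) (auto simp: less_imp_le[OF lln_density_pos])
  from n show "(\<integral>z. lln_density \<sigma> \<mu> a z \<partial>lborel) = 1"
    by (subst integral_eq_nn_integral) (auto simp: less_imp_le[OF lln_density_pos])
qed

text \<open>Both densities mix the same kernel over two Gaussians that differ by a shift, so the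
  moment is at most that of the Gaussians.\<close>
lemma renyi_integral_lln_scale:
  assumes \<beta>: "\<beta> > 1"
  shows "renyi_integral \<beta> lborel (lln_density \<sigma> \<mu> a) (lln_density \<sigma> \<nu> a)
    \<le> ennreal (exp (\<beta> * (\<beta> - 1) * (\<mu> - \<nu>)\<^sup>2 / 2))"
proof -
  let ?F = "\<lambda>y. normal_density \<mu> 1 y powr \<beta> * normal_density \<nu> 1 y powr (1 - \<beta>)"
  have "renyi_integral \<beta> lborel (lln_density \<sigma> \<mu> a) (lln_density \<sigma> \<nu> a)
     \<le> (\<integral>\<^sup>+ z. renyi_integral \<beta> lborel (\<lambda>y. normal_density \<mu> 1 y * lln_kernel \<sigma> a z y)
            (\<lambda>y. normal_density \<nu> 1 y * lln_kernel \<sigma> a z y) \<partial>lborel)"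
    unfolding renyi_integral_def[of \<beta> lborel "lln_density \<sigma> \<mu> a"] lln_density_def
    using lln_density_pos[of \<sigma> _ a] integrable_normal_lln_kernel \<beta>
    by (intro nn_integral_mono renyi_integral_jensen)
       (auto simp: lln_density_def lln_kernel_pos normal_density_pos)
  also have "\<dots> = (\<integral>\<^sup>+ z. \<integral>\<^sup>+ y. ennreal (?F y * lln_kernel \<sigma> a z y) \<partial>lborel \<partial>lborel)"
    unfolding renyi_integral_def
    using lln_kernel_pos by (intro nn_integral_cong arg_cong[where f = ennreal])
      (simp add: powr_mult powr_diff less_imp_le field_simps)
  also have "\<dots> = (\<integral>\<^sup>+ y. \<integral>\<^sup>+ z. ennreal (?F y * lln_kernel \<sigma> a z y) \<partial>lborel \<partial>lborel)"
    by (intro lborel_pair.Fubini') auto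
  also have "\<dots> = (\<integral>\<^sup>+ y. ennreal (?F y) * (\<integral>\<^sup>+ z. ennreal (lln_kernel \<sigma> a z y) \<partial>lborel) \<partial>lborel)"
    by (simp add: ennreal_mult' nn_integral_cmult)
  also have "\<dots> = (\<integral>\<^sup>+ y. ennreal (?F y) \<partial>lborel)"
    by (simp add: nn_integral_lln_kernel)
  also have "\<dots> = ennreal (exp (\<beta> * (\<beta> - 1) * (\<mu> - \<nu>)\<^sup>2 / 2))"
    using renyi_integral_normal_shift by (simp add: renyi_integral_def)
  finally show ?thesis .
qed

text \<open>The intermediate distribution has the centre of the first and the scale of the second
  one. Rescaling costs \<^term>\<open>c\<close> by the Gaussian bound; translating costs \<^term>\<open>d\<close>,
  because the logarithmic Lipschitz bound keeps the density ratio within $[e^{-d},e^d]$.\<close>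
lemma renyi_integral_lln:
  assumes c: "c > 0" "\<bar>\<mu> - \<nu>\<bar> \<le> c"
    and d: "d > 0" "exp (3 * \<sigma>\<^sup>2 / 2 - \<sigma> * \<nu>) * \<bar>a - a'\<bar> \<le> d"
    and \<alpha>: "\<alpha> > 1"
  shows "renyi_integral \<alpha> lborel (lln_density \<sigma> \<mu> a) (lln_density \<sigma> \<nu> a')
    \<le> ennreal (exp (\<alpha> * (\<alpha> - 1) * (c + d)\<^sup>2 / 2))"
proof (rule renyi_integral_triangle[where r = "lln_density \<sigma> \<nu> a", OF _ _ _ _ _ _ c(1) d(1) _ _ \<alpha>])
  fix \<beta> :: real assume \<beta>: "\<beta> > 1"
  have "(\<mu> - \<nu>)\<^sup>2 \<le> c\<^sup>2" using c by (simp add: abs_le_square_iff [symmetric])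
  then have "exp (\<beta> * (\<beta> - 1) * (\<mu> - \<nu>)\<^sup>2 / 2) \<le> exp (\<beta> * (\<beta> - 1) * c\<^sup>2 / 2)"
    using \<beta> by (auto intro!: divide_right_mono mult_left_mono)
  with renyi_integral_lln_scale[OF \<beta>, of \<sigma> \<mu> a \<nu>]
  show "renyi_integral \<beta> lborel (lln_density \<sigma> \<mu> a) (lln_density \<sigma> \<nu> a) \<le> ennreal (exp (\<beta> * (\<beta> - 1) * c\<^sup>2 / 2))"
    by (meson ennreal_leI order_trans)
  have ratio: "lln_density \<sigma> \<nu> u z \<le> exp d * lln_density \<sigma> \<nu> v z"
    if "\<bar>u - v\<bar> = \<bar>a - a'\<bar>" for u v z
  proof -
    have "exp (- d) * lln_density \<sigma> \<nu> u z \<le> exp (- (exp (3 * \<sigma>\<^sup>2 / 2 - \<sigma> * \<nu>) * \<bar>u - v\<bar>)) * lln_density \<sigma> \<nu> u z"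
      using d that lln_density_pos[of \<sigma> \<nu> u z] by (intro mult_right_mono) auto
    also have "\<dots> \<le> lln_density \<sigma> \<nu> v z" by (rule lln_density_log_lipschitz)
    finally show ?thesis by (simp add: exp_minus field_simps)
  qed
  show "renyi_integral \<beta> lborel (lln_density \<sigma> \<nu> a) (lln_density \<sigma> \<nu> a') \<le> ennreal (exp (\<beta> * (\<beta> - 1) * d\<^sup>2 / 2))"
    using d(1) \<beta> by (intro renyi_integral_bounded_ratio lln_density_integral lln_density_pos ratio) (auto simp: abs_minus_commute)
qed (auto simp: lln_density_pos)

section \<open>Divergences of measures\<close>

text \<open>The quotient of positive densities is a Radon--Nikodym derivative, and that derivative is
  unique almost everywhere.\<close>
lemma renyi_moment_density:
  fixes p q :: "'a \<Rightarrow> real"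
  assumes [measurable]: "p \<in> borel_measurable M" "q \<in> borel_measurable M"
    and pos: "\<And>z. p z > 0" "\<And>z. q z > 0"
    and sf: "sigma_finite_measure (density M q)"
  shows "absolutely_continuous (density M q) (density M p)"
    and "renyi_moment \<alpha> (density M p) (density M q) = renyi_integral \<alpha> M p q"
proof -
  let ?P = "density M p" and ?Q = "density M q"
  have eq: "density ?Q (\<lambda>z. ennreal (p z / q z)) = ?P"
    by (subst density_density_eq) (auto simp: ennreal_mult' [symmetric] less_imp_le pos less_imp_neq[OF pos(2), symmetric])
  show ac: "absolutely_continuous ?Q ?P"
    unfolding eq [symmetric] by (rule absolutely_continuousI_density) simp
  have "AE z in ?Q. ennreal (p z / q z) = RN_deriv ?Q ?P z"
    by (rule sigma_finite_measure.RN_deriv_unique[OF sf _ eq]) simp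
  then have ae: "AE z in ?P. ennreal (p z / q z) = RN_deriv ?Q ?P z"
    by (rule absolutely_continuous_AE[OF _ ac, rotated]) simp
  have "renyi_moment \<alpha> ?P ?Q = (\<integral>\<^sup>+ z. ennreal ((p z / q z) powr (\<alpha> - 1)) \<partial>?P)"
    unfolding renyi_moment_def
  proof (rule nn_integral_cong_AE)
    show "AE z in ?P. ennreal (enn2real (RN_deriv ?Q ?P z) powr (\<alpha> - 1)) = ennreal ((p z / q z) powr (\<alpha> - 1))"
      using ae
    proof eventually_elim
      case (elim z)
      then show ?case using pos[of z] by (simp flip: elim add: less_imp_le)
    qed
  qed
  also have "\<dots> = (\<integral>\<^sup>+ z. ennreal (p z * (p z / q z) powr (\<alpha> - 1)) \<partial>M)"
    using pos by (subst nn_integral_density) (auto simp: ennreal_mult' less_imp_le)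
  also have "\<dots> = renyi_integral \<alpha> M p q"
    unfolding renyi_integral_def
  proof (intro nn_integral_cong arg_cong[where f = ennreal])
    fix z
    show "p z * (p z / q z) powr (\<alpha> - 1) = p z powr \<alpha> * q z powr (1 - \<alpha>)"
      using pos(1)[of z] pos(2)[of z] by (simp add: powr_divide powr_diff)
  qed
  finally show "renyi_moment \<alpha> ?P ?Q = renyi_integral \<alpha> M p q" .
qed

lemma renyi_divergence_le:
  assumes "absolutely_continuous Q P" "renyi_moment \<alpha> P Q \<le> ennreal (exp ((\<alpha> - 1) * c))"
    and "\<alpha> > 1" "c \<ge> 0"
  shows "renyi_divergence \<alpha> P Q \<le> ereal c"
proof -
  define m where "m = enn2real (renyi_moment \<alpha> P Q)"
  have fin: "renyi_moment \<alpha> P Q < \<infinity>"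
    using assms(2) by (auto simp: less_top [symmetric] top_unique)
  have m: "0 \<le> m" "m \<le> exp ((\<alpha> - 1) * c)"
    using enn2real_mono[OF assms(2)] by (auto simp: m_def)
  have "ln m \<le> (\<alpha> - 1) * c"
  proof (cases "m = 0")
    case False
    then have "ln m \<le> ln (exp ((\<alpha> - 1) * c))" using m by (subst ln_le_cancel_iff) auto
    then show ?thesis by simp
  qed (use assms in simp)
  then have "1 / (\<alpha> - 1) * ln m \<le> c" using assms by (simp add: field_simps)
  then show ?thesis using fin assms by (simp add: renyi_divergence_def m_def)
qed

text \<open>This covers the case of zero smoothed sensitivity, where the outputs are point masses
  and have no Lebesgue density.\<close>
lemma renyi_divergence_self_le_0:
  assumes "prob_space P" "\<alpha> > 1"
  shows "renyi_divergence \<alpha> P P \<le> 0"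
proof -
  interpret P: prob_space P by fact
  have "AE z in P. 1 = RN_deriv P P z"
    by (rule P.RN_deriv_unique) (auto simp: density_1)
  then have "renyi_moment \<alpha> P P = (\<integral>\<^sup>+ z. 1 \<partial>P)"
    unfolding renyi_moment_def
    by (intro nn_integral_cong_AE) (auto elim!: eventually_mono simp: eq_commute[of 1])
  then have "renyi_moment \<alpha> P P \<le> ennreal (exp ((\<alpha> - 1) * 0))"
    by (simp add: P.emeasure_space_1)
  then show ?thesis
    using renyi_divergence_le[of P P \<alpha> 0] assms(2) by (simp add: absolutely_continuous_def zero_ereal_def)
qed

section \<open>Smoothed sensitivity\<close>
lemma hamming_dist_commute: "length x = length y \<Longrightarrow> hamming_dist x y = hamming_dist y x"
  unfolding hamming_dist_def by (simp add: eq_commute)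

lemma hamming_dist_triangle:
  assumes "length x = length y" "length y = length z"
  shows "hamming_dist x z \<le> hamming_dist x y + hamming_dist y z"
proof -
  have "hamming_dist x z \<le> card ({i. i < length x \<and> x ! i \<noteq> y ! i} \<union> {i. i < length y \<and> y ! i \<noteq> z ! i})"
    unfolding hamming_dist_def using assms by (intro card_mono) auto
  then show ?thesis unfolding hamming_dist_def using card_Un_le order_trans by blast
qed

lemma hamming_dist_refl: "hamming_dist x x = 0"
  by (simp add: hamming_dist_def)

lemma local_le_smooth_sensitivity:
  assumes "x \<in> nlists n X"
  shows "local_sensitivity X n f x \<le> smooth_sensitivity X n f t x"
  unfolding smooth_sensitivity_def
  using assms by (intro SUP_upper2[of x]) (auto simp: hamming_dist_refl)

lemma neighbour_diff_le_smooth_sensitivity: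
  assumes "x \<in> nlists n X" "y \<in> nlists n X" "hamming_dist x y \<le> 1"
  shows "ennreal \<bar>f y - f x\<bar> \<le> smooth_sensitivity X n f t x"
proof -
  have "ennreal \<bar>f y - f x\<bar> \<le> local_sensitivity X n f x"
    unfolding local_sensitivity_def using assms by (intro SUP_upper) auto
  also have "\<dots> \<le> smooth_sensitivity X n f t x" by (rule local_le_smooth_sensitivity[OF assms(1)])
  finally show ?thesis .
qed

text \<open>The discount factor $e^{-t\,d(x,w)}$ is chosen for this property: by the triangle
  inequality, moving from \<^term>\<open>x\<close> to \<^term>\<open>y\<close> changes every discount by at most
  $e^{t\,d(x,y)}$.\<close>
lemma smooth_sensitivity_le_exp_mult:
  assumes x: "x \<in> nlists n X" and y: "y \<in> nlists n X" and t: "t \<ge> 0"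
  shows "smooth_sensitivity X n f t x
    \<le> ennreal (exp (t * real (hamming_dist x y))) * smooth_sensitivity X n f t y"
  unfolding smooth_sensitivity_def[of X n f t x]
proof (rule SUP_least)
  fix w assume w: "w \<in> nlists n X"
  have "hamming_dist y w \<le> hamming_dist y x + hamming_dist x w"
    using x y w by (intro hamming_dist_triangle) auto
  also have "hamming_dist y x = hamming_dist x y"
    using x y by (intro hamming_dist_commute) auto
  finally have "t * real (hamming_dist y w) \<le> t * (real (hamming_dist x y) + real (hamming_dist x w))"
    using t by (intro mult_left_mono) linarith+
  then have "exp (- t * real (hamming_dist x w))
     \<le> exp (t * real (hamming_dist x y)) * exp (- t * real (hamming_dist y w))"
    by (simp add: exp_add [symmetric] algebra_simps)
  then have "ennreal (exp (- t * real (hamming_dist x w))) * local_sensitivity X n f w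
     \<le> ennreal (exp (t * real (hamming_dist x y)) * exp (- t * real (hamming_dist y w))) * local_sensitivity X n f w"
    by (intro mult_right_mono ennreal_leI) auto
  also have "\<dots> = ennreal (exp (t * real (hamming_dist x y))) *
      (ennreal (exp (- t * real (hamming_dist y w))) * local_sensitivity X n f w)"
    by (simp add: ennreal_mult mult.assoc)
  also have "\<dots> \<le> ennreal (exp (t * real (hamming_dist x y))) * smooth_sensitivity X n f t y"
    unfolding smooth_sensitivity_def using w by (intro mult_left_mono SUP_upper) auto
  finally show "ennreal (exp (- t * real (hamming_dist x w))) * local_sensitivity X n f w
     \<le> ennreal (exp (t * real (hamming_dist x y))) * smooth_sensitivity X n f t y" .
qed

section \<open>Privacy of smoothed-sensitivity noise\<close>
lemma renyi_divergence_affine_LLN: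
  assumes pos: "b > 0" "b' > 0" "\<sigma> > 0" "s > 0" "t > 0" and \<alpha>: "\<alpha> > 1"
    and scale: "b \<le> exp t * b'" "b' \<le> exp t * b"
    and shift: "\<bar>a - a'\<bar> \<le> s * b'"
  shows "renyi_divergence \<alpha> (distr (LLN \<sigma>) borel (\<lambda>z. a + b * z)) (distr (LLN \<sigma>) borel (\<lambda>z. a' + b' * z))
    \<le> ereal (1 / 2 * (t / \<sigma> + exp (3 * \<sigma>\<^sup>2 / 2) * s)\<^sup>2 * \<alpha>)"
proof -
  define \<epsilon> where "\<epsilon> = t / \<sigma> + exp (3 * \<sigma>\<^sup>2 / 2) * s"
  let ?p = "lln_density \<sigma> (ln b / \<sigma>) a" and ?q = "lln_density \<sigma> (ln b' / \<sigma>) a'"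
  have "ln b \<le> ln (exp t * b')" "ln b' \<le> ln (exp t * b)"
    using pos scale by (subst ln_le_cancel_iff; simp)+
  then have "\<bar>ln b - ln b'\<bar> \<le> t" using pos by (simp add: ln_mult)
  then have 1: "\<bar>ln b / \<sigma> - ln b' / \<sigma>\<bar> \<le> t / \<sigma>"
    using pos by (simp add: diff_divide_distrib [symmetric] divide_right_mono)
  \<comment> \<open>At scale \<^term>\<open>b'\<close> the logarithmic Lipschitz constant is $e^{3\sigma^2/2}/b'$.\<close>
  have "exp (3 * \<sigma>\<^sup>2 / 2 - \<sigma> * (ln b' / \<sigma>)) * \<bar>a - a'\<bar> = exp (3 * \<sigma>\<^sup>2 / 2) * (\<bar>a - a'\<bar> / b')"
    using pos by (simp add: exp_diff)
  also have "\<dots> \<le> exp (3 * \<sigma>\<^sup>2 / 2) * s"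
    using shift pos by (intro mult_left_mono) (auto simp: field_simps)
  finally have "renyi_integral \<alpha> lborel ?p ?q \<le> ennreal (exp (\<alpha> * (\<alpha> - 1) * \<epsilon>\<^sup>2 / 2))"
    unfolding \<epsilon>_def using pos \<alpha> 1 by (intro renyi_integral_lln) auto
  moreover have sf: "sigma_finite_measure (density lborel ?q)"
  proof (intro prob_space_imp_sigma_finite prob_spaceI)
    show "emeasure (density lborel ?q) (space (density lborel ?q)) = 1"
      using lln_density_integral[of \<sigma> "ln b' / \<sigma>" a']
      by (simp add: emeasure_density nn_integral_eq_integral less_imp_le[OF lln_density_pos])
  qed
  ultimately have "renyi_moment \<alpha> (density lborel ?p) (density lborel ?q) \<le> ennreal (exp ((\<alpha> - 1) * (1 / 2 * \<epsilon>\<^sup>2 * \<alpha>)))"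
    by (subst renyi_moment_density(2)) (auto simp: lln_density_pos mult_ac)
  then show ?thesis
    unfolding distr_affine_LLN[OF pos(1,3)] distr_affine_LLN[OF pos(2,3)] \<epsilon>_def [symmetric]
    using \<alpha> sf by (intro renyi_divergence_le renyi_moment_density(1)) (auto simp: lln_density_pos)
qed

theorem proposition3:
  fixes X :: "'a set" and n :: nat and f :: "'a list \<Rightarrow> real"
    and s t \<sigma> \<epsilon> :: real
    and \<Omega> :: "'b measure" and Z :: "'b \<Rightarrow> real"
  assumes "n \<ge> 1"
    and "s > 0" and "t > 0" and "\<sigma> > 0"
    and "\<And>x. x \<in> nlists n X \<Longrightarrow> smooth_sensitivity X n f t x < \<infinity>"
    and "prob_space \<Omega>" and "Z \<in> borel_measurable \<Omega>" and "distr \<Omega> borel Z = LLN \<sigma>"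
    and "\<epsilon> = t / \<sigma> + exp (3 * \<sigma>\<^sup>2 / 2) * s"
  shows "CDP X n (1 / 2 * \<epsilon>\<^sup>2)
    (\<lambda>x. distr \<Omega> borel (\<lambda>\<omega>. f x + 1 / s * enn2real (smooth_sensitivity X n f t x) * Z \<omega>))"
  unfolding CDP_def
proof (intro ballI impI allI)
  note [measurable] = assms(7)
  fix x y and \<alpha> :: real
  assume x: "x \<in> nlists n X" and y: "y \<in> nlists n X" and nb: "hamming_dist x y \<le> 1" and \<alpha>: "1 < \<alpha>"
  define S where "S x = enn2real (smooth_sensitivity X n f t x)" for x
  have S: "ennreal (S u) = smooth_sensitivity X n f t u" if "u \<in> nlists n X" for u
    using assms(5)[OF that] by (simp add: S_def less_top)
  have S0: "S u \<ge> 0" for u by (simp add: S_def)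
  have nb': "hamming_dist y x \<le> 1"
    using nb x y hamming_dist_commute[of x y] by simp
  have growth: "S u \<le> exp t * S v"
    if u: "u \<in> nlists n X" and v: "v \<in> nlists n X" and uv: "hamming_dist u v \<le> 1" for u v
  proof -
    have "ennreal (S u) \<le> ennreal (exp (t * real (hamming_dist u v)) * S v)"
      using smooth_sensitivity_le_exp_mult[OF u v, of t f] assms(3) u v by (simp add: S ennreal_mult')
    then have "S u \<le> exp (t * real (hamming_dist u v)) * S v" using S0[of v] by simp
    also have "\<dots> \<le> exp t * S v" using S0[of v] uv assms(3) by (intro mult_right_mono) auto
    finally show ?thesis .
  qed
  have shift: "\<bar>f x - f y\<bar> \<le> S y"
    using neighbour_diff_le_smooth_sensitivity[OF y x nb', of f t] S0[of y] by (simp add: S[OF y, symmetric])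
  have law: "distr \<Omega> borel (\<lambda>\<omega>. f u + 1 / s * S u * Z \<omega>) = distr (LLN \<sigma>) borel (\<lambda>z. f u + S u / s * z)" for u
    unfolding assms(8) [symmetric] by (subst distr_distr) (auto simp: comp_def)
  have "renyi_divergence \<alpha> (distr \<Omega> borel (\<lambda>\<omega>. f x + 1 / s * S x * Z \<omega>))
      (distr \<Omega> borel (\<lambda>\<omega>. f y + 1 / s * S y * Z \<omega>)) \<le> ereal (1 / 2 * \<epsilon>\<^sup>2 * \<alpha>)"
  proof (cases "S y = 0")
    case True
    then have "S x = 0" "f x = f y" using growth[OF x y nb] S0[of x] shift by auto
    with True have "renyi_divergence \<alpha> (distr \<Omega> borel (\<lambda>\<omega>. f x + 1 / s * S x * Z \<omega>))
      (distr \<Omega> borel (\<lambda>\<omega>. f y + 1 / s * S y * Z \<omega>)) \<le> 0"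
      using \<alpha> assms(6) by (auto intro!: renyi_divergence_self_le_0 prob_space.prob_space_distr)
    also have "0 \<le> ereal (1 / 2 * \<epsilon>\<^sup>2 * \<alpha>)" using \<alpha> by simp
    finally show ?thesis .
  next
    case False
    then have Sy: "S y > 0" using S0[of y] by simp
    then have Sx: "S x > 0" using growth[OF y x nb'] S0[of x] by (cases "S x = 0") auto
    show ?thesis
      unfolding law assms(9)
      using Sx Sy assms(2-4) \<alpha> growth[OF x y nb] growth[OF y x nb'] shift
      by (intro renyi_divergence_affine_LLN) (auto simp: divide_right_mono)
  qed
  then show "renyi_divergence \<alpha>
      (distr \<Omega> borel (\<lambda>\<omega>. f x + 1 / s * enn2real (smooth_sensitivity X n f t x) * Z \<omega>))
      (distr \<Omega> borel (\<lambda>\<omega>. f y + 1 / s * enn2real (smooth_sensitivity X n f t y) * Z \<omega>))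
     \<le> ereal (1 / 2 * \<epsilon>\<^sup>2 * \<alpha>)"
    by (simp add: S_def)
qed

end
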